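(* Let $\mathcal A_1=\langle Q_1,\Sigma,\Delta_1,\{q_1\}\rangle$ and $\mathcal A_2=\langle Q_2,\Sigma,\Delta_2,\{q_2\}\rangle$ be tagged TAs whose languages consist of tagged $n$-qubit trees, and assume that all leaf symbols of $\mathcal A_1$ and $\mathcal A_2$ have the same fifth component $k$. Let $\circ\in\{+,-\}$ and let $\mathsf{Bin}(\mathcal A_1,\mathcal A_2,\circ)$ be the TA with states $Q_1\times Q_2$, root state $(q_1,q_2)$, and transitions \begin{itemize} \item $(q^1,q^2)\xrightarrow{x_j^i}((q^1_l,q^2_l),(q^1_r,q^2_r))$ for all $q^1\xrightarrow{x_j^i}(q^1_l,q^1_r)\in\Delta_1$ and $q^2\xrightarrow{x_j^i}(q^2_l,q^2_r)\in\Delta_2$ (same symbol); \item $(q^1,q^2)\xrightarrow{(a_1\circ a_2,\,b_1\circ b_2,\,c_1\circ c_2,\,d_1\circ d_2,\,k)}()$ for all $q^1\xrightarrow{(a_1,b_1,c_1,d_1,k)}()\in\Delta_1$ and $q^2\xrightarrow{(a_2,b_2,c_2,d_2,k)}()\in\Delta_2$. \end{itemize} Then $\mathcal L(\mathsf{Bin}(\mathcal A_1,\mathcal A_2,\circ))=\{T_1\circ T_2\mid T_1\in\mathcal L(\mathcal A_1),\ T_2\in\mathcal L(\mathcal A_2),\ \mathrm{Tag}(T_1)=\mathrm{Tag}(T_2)\}$.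
   Context: Tree automata: a TA is $\mathcal A=\langle Q,\Sigma,\Delta,\mathcal R\rangle$ with finite state set $Q$, ranked alphabet $\Sigma$ of binary and constant symbols, root states $\mathcal R\subseteq Q$, and transitions internal $q\xrightarrow{f}(q_0,q_1)$ or leaf $q\xrightarrow{c}()$. It is assumed no state has leaf transitions with two different constants. A run on a binary tree labels each node with a state so that each leaf labelled $c$ with state $q$ has $q\xrightarrow{c}()\in\Delta$ and each internal node labelled $f$ with state $q$ and children states $q_0$ (left), $q_1$ (right) has $q\xrightarrow{f}(q_0,q_1)\in\Delta$; accepting if the root state is in $\mathcal R$; $\mathcal L(\mathcal A)$ is the set of trees with an accepting run. Leaf symbols are tuples $(a,b,c,d,k)\in\mathbb Z^5$ representing $(1/\sqrt2)^k(a+b\omega+c\omega^2+d\omega^3)$, $\omega=e^{i\pi/4}$. A tagged TA has binary symbols $x_k^j$ ($k$ qubit index, $j$ tag) with distinct internal transitions carrying distinct symbols. A tagged $n$-qubit tree is a full binary tree of height $n$ whose internal nodes at depth $k-1$ are labelled by symbols $x_k^j$ and whose leaves are labelled in $\mathbb Z^5$. $\mathrm{Tag}(T)$ replaces every leaf label by a special symbol $\square$. For trees $T_1,T_2$ with $\mathrm{Tag}(T_1)=\mathrm{Tag}(T_2)$, $T_1\pm T_2$ is the tree with the same internal labels whose leaf at each position is the sum/difference of the complex amplitudes of $T_1$ and $T_2$ at that position (for equal $k$, represented componentwise by $(a_1\pm a_2,b_1\pm b_2,c_1\pm c_2,d_1\pm d_2,k)$). *)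

theory Defs
  imports Complex_Main
begin

section \<open>Binary trees and tree automata\<close>

datatype ('f, 'c) btree = Leaf 'c | Node 'f "('f, 'c) btree" "('f, 'c) btree"

record ('f, 'c) ranked_alphabet =
  binary_syms :: "'f set"
  const_syms :: "'c set"

text \<open>
  An internal transition \<open>(q, f, q0, q1)\<close> stands for $q \to^f (q_0, q_1)$, a leaf transition
  \<open>(q, c)\<close> for $q \to^c ()$.
\<close>

record ('q, 'f, 'c) ta =
  states :: "'q set"
  alphabet :: "('f, 'c) ranked_alphabet"
  internal_trans :: "('q \<times> 'f \<times> 'q \<times> 'q) set"
  leaf_trans :: "('q \<times> 'c) set"
  root_states :: "'q set"

definition tree_automaton :: "('q, 'f, 'c) ta \<Rightarrow> bool" where
  "tree_automaton A \<longleftrightarrow>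
     finite (states A) \<and>
     root_states A \<subseteq> states A \<and>
     internal_trans A \<subseteq> states A \<times> binary_syms (alphabet A) \<times> states A \<times> states A \<and>
     leaf_trans A \<subseteq> states A \<times> const_syms (alphabet A) \<and>
     (\<forall>q c c'. (q, c) \<in> leaf_trans A \<longrightarrow> (q, c') \<in> leaf_trans A \<longrightarrow> c = c')"

text \<open>
  A run labels tree positions with states. Positions are words over \<^typ>\<open>bool\<close>, with
  \<^const>\<open>False\<close> for the left and \<^const>\<open>True\<close> for the right child. The value of the labelling
  outside the positions of the tree is irrelevant.
\<close>

primrec is_run :: "('q, 'f, 'c) ta \<Rightarrow> ('f, 'c) btree \<Rightarrow> (bool list \<Rightarrow> 'q) \<Rightarrow> bool" where
  "is_run A (Leaf c) \<rho> \<longleftrightarrow> (\<rho> [], c) \<in> leaf_trans A"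
| "is_run A (Node f l r) \<rho> \<longleftrightarrow>
     (\<rho> [], f, \<rho> [False], \<rho> [True]) \<in> internal_trans A \<and>
     is_run A l (\<lambda>p. \<rho> (False # p)) \<and> is_run A r (\<lambda>p. \<rho> (True # p))"

definition lang :: "('q, 'f, 'c) ta \<Rightarrow> ('f, 'c) btree set" where
  "lang A = {T. \<exists>\<rho>. is_run A T \<rho> \<and> \<rho> [] \<in> root_states A}"


section \<open>Amplitudes\<close>

text \<open>The tuple \<open>(a, b, c, d, k)\<close>, which represents a complex number in a non-unique way.\<close>

type_synonym amp_sym = "int \<times> int \<times> int \<times> int \<times> int"

definition \<omega> :: complex where
  "\<omega> = exp (\<i> * complex_of_real pi / 4)"

fun amplitude :: "amp_sym \<Rightarrow> complex" where
  "amplitude (a, b, c, d, k) =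
     complex_of_real (1 / sqrt 2) powi k *
       (of_int a + of_int b * \<omega> + of_int c * \<omega>^2 + of_int d * \<omega>^3)"

datatype pm = Plus | Minus

fun app_pm :: "pm \<Rightarrow> 'a :: ab_group_add \<Rightarrow> 'a \<Rightarrow> 'a" where
  "app_pm Plus x y = x + y"
| "app_pm Minus x y = x - y"

text \<open>
  A tuple representing the sum or difference of the two amplitudes (see \<open>amplitude_amp_pm\<close> below).
  For equal exponents it is the componentwise one; for different exponents no particular
  representation is prescribed.
\<close>

fun amp_pm :: "pm \<Rightarrow> amp_sym \<Rightarrow> amp_sym \<Rightarrow> amp_sym" where
  "amp_pm s (a1, b1, c1, d1, k1) (a2, b2, c2, d2, k2) =
     (if k1 = k2
      then (app_pm s a1 a2, app_pm s b1 b2, app_pm s c1 c2, app_pm s d1 d2, k1)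
      else (SOME z. amplitude z =
              app_pm s (amplitude (a1, b1, c1, d1, k1)) (amplitude (a2, b2, c2, d2, k2))))"


section \<open>Tagged trees and tagged tree automata\<close>

text \<open>\<open>TSym k j\<close> is the symbol $x_k^j$; qubit indices start at 1.\<close>

datatype 'j tsym = TSym nat 'j

text \<open>
  \<open>tagged_subtree i m T\<close>: the tree \<open>T\<close> is full of height \<open>m\<close> and the nodes at its depth \<open>e\<close>
  carry qubit index \<open>i + e\<close>.
\<close>

fun tagged_subtree :: "nat \<Rightarrow> nat \<Rightarrow> ('j tsym, amp_sym) btree \<Rightarrow> bool" where
  "tagged_subtree i 0 (Leaf c) \<longleftrightarrow> True"
| "tagged_subtree i (Suc m) (Node (TSym k j) l r) \<longleftrightarrow>
     k = i \<and> tagged_subtree (Suc i) m l \<and> tagged_subtree (Suc i) m r"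
| "tagged_subtree _ _ _ \<longleftrightarrow> False"

definition tagged_tree :: "nat \<Rightarrow> ('j tsym, amp_sym) btree \<Rightarrow> bool" where
  "tagged_tree n T \<longleftrightarrow> tagged_subtree 1 n T"

definition tagged_ta :: "('q, 'j tsym, amp_sym) ta \<Rightarrow> bool" where
  "tagged_ta A \<longleftrightarrow> tree_automaton A \<and>
     inj_on (\<lambda>(q, f, q0, q1). f) (internal_trans A)"

datatype box = Box

definition Tag :: "('f, 'c) btree \<Rightarrow> ('f, box) btree" where
  "Tag T = map_btree id (\<lambda>_. Box) T"

text \<open>Only meaningful for trees with the same \<open>Tag\<close>.\<close>

fun tree_pm :: "pm \<Rightarrow> ('f, amp_sym) btree \<Rightarrow> ('f, amp_sym) btree \<Rightarrow> ('f, amp_sym) btree" where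
  "tree_pm s (Leaf x) (Leaf y) = Leaf (amp_pm s x y)"
| "tree_pm s (Node f l r) (Node f' l' r') = Node f (tree_pm s l l') (tree_pm s r r')"
| "tree_pm s _ _ = undefined"


section \<open>The binary operation on automata\<close>

text \<open>
  The componentwise leaf symbols need not belong to the constants of the given automata, so these
  are added to the alphabet.
\<close>

definition Bin_trans :: "('q1, 'j tsym, amp_sym) ta \<Rightarrow> ('q2, 'j tsym, amp_sym) ta \<Rightarrow>
    (('q1 \<times> 'q2) \<times> 'j tsym \<times> ('q1 \<times> 'q2) \<times> ('q1 \<times> 'q2)) set" where
  "Bin_trans A1 A2 =
     {((p1, p2), x, (l1, l2), (r1, r2)) | p1 p2 x l1 l2 r1 r2.
        (p1, x, l1, r1) \<in> internal_trans A1 \<and> (p2, x, l2, r2) \<in> internal_trans A2}"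

definition Bin_leaf :: "('q1, 'j tsym, amp_sym) ta \<Rightarrow> ('q2, 'j tsym, amp_sym) ta \<Rightarrow> pm \<Rightarrow>
    (('q1 \<times> 'q2) \<times> amp_sym) set" where
  "Bin_leaf A1 A2 s =
     {((p1, p2), (app_pm s a1 a2, app_pm s b1 b2, app_pm s c1 c2, app_pm s d1 d2, k)) |
        p1 p2 a1 b1 c1 d1 a2 b2 c2 d2 k.
        (p1, (a1, b1, c1, d1, k)) \<in> leaf_trans A1 \<and> (p2, (a2, b2, c2, d2, k)) \<in> leaf_trans A2}"

definition Bin :: "('q1, 'j tsym, amp_sym) ta \<Rightarrow> ('q2, 'j tsym, amp_sym) ta \<Rightarrow> pm \<Rightarrow>
    ('q1 \<times> 'q2, 'j tsym, amp_sym) ta" where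
  "Bin A1 A2 s = \<lparr>
     states = states A1 \<times> states A2,
     alphabet = \<lparr>
       binary_syms = binary_syms (alphabet A1) \<union> binary_syms (alphabet A2),
       const_syms = const_syms (alphabet A1) \<union> const_syms (alphabet A2) \<union> snd ` Bin_leaf A1 A2 s \<rparr>,
     internal_trans = Bin_trans A1 A2,
     leaf_trans = Bin_leaf A1 A2 s,
     root_states = root_states A1 \<times> root_states A2 \<rparr>"


section \<open>Consistency of the definitions\<close>

lemma amplitude_raise_one: "\<exists>a' b' c' d'. amplitude (a, b, c, d, k) = amplitude (a', b', c', d', k + 1)"
proof (intro exI)
  have cis: "\<omega> = cis (pi / 4)"
    by (simp add: \<omega>_def cis_conv_exp mult.commute)
  have w2: "\<omega>^2 = \<i>"
    unfolding cis by (simp only: DeMoivre) simp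
  have w3: "\<omega>^3 = \<i> * \<omega>"
    unfolding w2[symmetric] by (simp add: power2_eq_square power3_eq_cube)
  have r2: "\<omega> - \<i> * \<omega> = complex_of_real (sqrt 2)"
    unfolding cis by (simp add: complex_eq_iff cos_45 sin_45)
  have "complex_of_real (1 / sqrt 2) powi (k + 1) * complex_of_real (sqrt 2)
      = complex_of_real (1 / sqrt 2) powi k * (complex_of_real (1 / sqrt 2) * complex_of_real (sqrt 2))"
    by (subst power_int_add_1) auto
  then have step: "complex_of_real (1 / sqrt 2) powi k
      = complex_of_real (1 / sqrt 2) powi (k + 1) * (\<omega> - \<i> * \<omega>)"
    unfolding r2 by (simp flip: of_real_mult)
  have ww: "\<omega> * \<omega> = \<i>"
    using w2 by (simp add: power2_eq_square)
  have ii: "\<i> * \<i> = -1"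
    by simp
  have "(w - i * w) * (A + B * w + C * i + D * (i * w)) = B - D + (A + C) * w + (B + D) * i + (C - A) * (i * w)"
    if "w * w = i" "i * i = -1" for A B C D w i :: complex
  proof -
    have "(w - i * w) * (A + B * w + C * i + D * (i * w)) =
        A * w + B * (w * w) + C * (i * w) + D * (i * (w * w))
        - A * (i * w) - B * (i * (w * w)) - C * ((i * i) * w) - D * ((i * i) * (w * w))"
      by (simp add: algebra_simps)
    then show ?thesis
      unfolding that by (simp add: algebra_simps)
  qed
  from this[OF ww ii, of "of_int a" "of_int b" "of_int c" "of_int d"]
  have "(\<omega> - \<i> * \<omega>) * (of_int a + of_int b * \<omega> + of_int c * \<i> + of_int d * (\<i> * \<omega>))
      = of_int (b - d) + of_int (a + c) * \<omega> + of_int (b + d) * \<i> + of_int (c - a) * (\<i> * \<omega>)"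
    by (simp only: of_int_add of_int_diff)
  then show "amplitude (a, b, c, d, k) = amplitude (b - d, a + c, b + d, c - a, k + 1)"
    unfolding amplitude.simps step w2 w3 mult.assoc by (rule arg_cong)
qed

lemma amplitude_raise: "\<exists>a' b' c' d'. amplitude (a, b, c, d, k) = amplitude (a', b', c', d', k + int m)"
proof (induction m)
  case 0
  have "amplitude (a, b, c, d, k) = amplitude (a, b, c, d, k + int 0)"
    by (simp only: of_nat_0 add_0_right)
  then show ?case by blast
next
  case (Suc m)
  then obtain a' b' c' d' where 1: "amplitude (a, b, c, d, k) = amplitude (a', b', c', d', k + int m)"
    by blast
  obtain a'' b'' c'' d'' where
    "amplitude (a', b', c', d', k + int m) = amplitude (a'', b'', c'', d'', k + int m + 1)"
    using amplitude_raise_one by blast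
  moreover have "k + int m + 1 = k + int (Suc m)"
    by simp
  ultimately show ?case
    using 1 by metis
qed

lemma amplitude_app_pm:
  "amplitude (app_pm s a1 a2, app_pm s b1 b2, app_pm s c1 c2, app_pm s d1 d2, k)
     = app_pm s (amplitude (a1, b1, c1, d1, k)) (amplitude (a2, b2, c2, d2, k))"
proof -
  have "E * (of_int (app_pm s a1 a2) + of_int (app_pm s b1 b2) * w + of_int (app_pm s c1 c2) * x
        + of_int (app_pm s d1 d2) * y)
      = app_pm s (E * (of_int a1 + of_int b1 * w + of_int c1 * x + of_int d1 * y))
          (E * (of_int a2 + of_int b2 * w + of_int c2 * x + of_int d2 * y))" for E w x y :: complex
    by (cases s) (simp_all add: algebra_simps)
  then show ?thesis
    unfolding amplitude.simps .
qed

lemma amplitude_amp_pm: "amplitude (amp_pm s x y) = app_pm s (amplitude x) (amplitude y)"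
proof -
  obtain a1 b1 c1 d1 k1 where x: "x = (a1, b1, c1, d1, k1)" by (cases x)
  obtain a2 b2 c2 d2 k2 where y: "y = (a2, b2, c2, d2, k2)" by (cases y)
  let ?k = "max k1 k2"
  have "k1 + int (nat (?k - k1)) = ?k" "k2 + int (nat (?k - k2)) = ?k"
    by simp_all
  then obtain a1' b1' c1' d1' a2' b2' c2' d2'
    where "amplitude x = amplitude (a1', b1', c1', d1', ?k)"
      and "amplitude y = amplitude (a2', b2', c2', d2', ?k)"
    using amplitude_raise[of a1 b1 c1 d1 k1 "nat (?k - k1)"]
      amplitude_raise[of a2 b2 c2 d2 k2 "nat (?k - k2)"] unfolding x y by metis
  then have "\<exists>z. amplitude z = app_pm s (amplitude x) (amplitude y)"
    using amplitude_app_pm by metis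
  then have "amplitude (SOME z. amplitude z = app_pm s (amplitude x) (amplitude y))
      = app_pm s (amplitude x) (amplitude y)"
    by (rule someI_ex)
  then show ?thesis
    unfolding x y amp_pm.simps by (cases "k1 = k2") (simp_all only: if_True if_False refl amplitude_app_pm)
qed

lemma tagged_ta_Bin:
  assumes "tagged_ta A1" "tagged_ta A2"
  shows "tagged_ta (Bin A1 A2 s)"
proof -
  have 1: "tree_automaton A1" "tree_automaton A2"
    and 2: "inj_on (\<lambda>(q, f, q0, q1). f) (internal_trans A1)" "inj_on (\<lambda>(q, f, q0, q1). f) (internal_trans A2)"
    using assms by (auto simp: tagged_ta_def)
  have u: "c = c'" if "(p, c) \<in> Bin_leaf A1 A2 s" "(p, c') \<in> Bin_leaf A1 A2 s" for p c c'
  proof -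
    from that(1) obtain p1 p2 a1 b1 c1 d1 a2 b2 c2 d2 k where x: "p = (p1, p2)"
        "c = (app_pm s a1 a2, app_pm s b1 b2, app_pm s c1 c2, app_pm s d1 d2, k)"
        "(p1, (a1, b1, c1, d1, k)) \<in> leaf_trans A1" "(p2, (a2, b2, c2, d2, k)) \<in> leaf_trans A2"
      unfolding Bin_leaf_def by blast
    from that(2) x(1) obtain a1' b1' c1' d1' a2' b2' c2' d2' k' where y:
        "c' = (app_pm s a1' a2', app_pm s b1' b2', app_pm s c1' c2', app_pm s d1' d2', k')"
        "(p1, (a1', b1', c1', d1', k')) \<in> leaf_trans A1" "(p2, (a2', b2', c2', d2', k')) \<in> leaf_trans A2"
      unfolding Bin_leaf_def by blast
    have "(a1, b1, c1, d1, k) = (a1', b1', c1', d1', k')"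
      using 1(1) x(3) y(2) unfolding tree_automaton_def by metis
    moreover have "(a2, b2, c2, d2, k) = (a2', b2', c2', d2', k')"
      using 1(2) x(4) y(3) unfolding tree_automaton_def by metis
    ultimately show "c = c'"
      using x(2) y(1) by simp
  qed
  have i: "inj_on (\<lambda>(q, f, q0, q1). f) (Bin_trans A1 A2)"
  proof (rule inj_onI)
    fix t t' assume t: "t \<in> Bin_trans A1 A2" "t' \<in> Bin_trans A1 A2"
      and eq: "(case t of (q, f, q0, q1) \<Rightarrow> f) = (case t' of (q, f, q0, q1) \<Rightarrow> f)"
    from t(1) obtain p1 p2 x l1 l2 r1 r2 where a: "t = ((p1, p2), x, (l1, l2), (r1, r2))"
        "(p1, x, l1, r1) \<in> internal_trans A1" "(p2, x, l2, r2) \<in> internal_trans A2"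
      unfolding Bin_trans_def by blast
    from t(2) eq a(1) obtain p1' p2' l1' l2' r1' r2' where b: "t' = ((p1', p2'), x, (l1', l2'), (r1', r2'))"
        "(p1', x, l1', r1') \<in> internal_trans A1" "(p2', x, l2', r2') \<in> internal_trans A2"
      unfolding Bin_trans_def by auto
    show "t = t'"
      using inj_onD[OF 2(1) _ a(2) b(2)] inj_onD[OF 2(2) _ a(3) b(3)] a(1) b(1) by simp
  qed
  have "q \<in> states A1 \<and> f \<in> binary_syms (alphabet A1) \<and> q0 \<in> states A1 \<and> q1 \<in> states A1"
    if "(q, f, q0, q1) \<in> internal_trans A1" for q f q0 q1
    using that 1(1) unfolding tree_automaton_def by auto
  moreover have "q \<in> states A2 \<and> f \<in> binary_syms (alphabet A2) \<and> q0 \<in> states A2 \<and> q1 \<in> states A2"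
    if "(q, f, q0, q1) \<in> internal_trans A2" for q f q0 q1
    using that 1(2) unfolding tree_automaton_def by auto
  ultimately have t: "Bin_trans A1 A2 \<subseteq> (states A1 \<times> states A2) \<times>
      (binary_syms (alphabet A1) \<union> binary_syms (alphabet A2)) \<times>
      (states A1 \<times> states A2) \<times> (states A1 \<times> states A2)"
    unfolding Bin_trans_def by clarsimp
  have "q \<in> states A1" if "(q, c) \<in> leaf_trans A1" for q c
    using that 1(1) unfolding tree_automaton_def by auto
  moreover have "q \<in> states A2" if "(q, c) \<in> leaf_trans A2" for q c
    using that 1(2) unfolding tree_automaton_def by auto
  ultimately have "fst ` Bin_leaf A1 A2 s \<subseteq> states A1 \<times> states A2"
    unfolding Bin_leaf_def by auto
  then have l: "Bin_leaf A1 A2 s \<subseteq> (states A1 \<times> states A2) \<times>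
      (const_syms (alphabet A1) \<union> const_syms (alphabet A2) \<union> snd ` Bin_leaf A1 A2 s)"
    by force
  have "finite (states A1 \<times> states A2)" "root_states A1 \<times> root_states A2 \<subseteq> states A1 \<times> states A2"
    using 1 unfolding tree_automaton_def by auto
  then show ?thesis
    using t l i unfolding tagged_ta_def tree_automaton_def Bin_def ta.simps ranked_alphabet.simps
    by - (intro conjI allI impI; (assumption | erule u, assumption))
qed

end

theory Submission
  imports Defs
begin

text \<open>\<open>Bin\<close> is a product construction: labelling positions with pairs of states
  amounts to giving two labellings. Trees with equal \<open>Tag\<close> have the same positions and
  internal symbols, so runs on \<open>T1\<close> and \<open>T2\<close> pair up to a run on
  \<open>tree_pm s T1 T2\<close> (\<open>is_run_Bin_pair\<close>). Conversely, a product run splits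
  into its two components, each a run on a suitable operand (\<open>is_run_Bin_proj\<close>). Root
  states match componentwise, which gives the two inclusions. The arithmetic is confined to the
  leaves, where the common exponent makes \<open>amp_pm\<close> agree with the symbols of
  \<open>Bin_leaf\<close>.\<close>

lemma is_run_Bin_pair:
  assumes "is_run A1 T1 \<rho>1" "is_run A2 T2 \<rho>2" "Tag T1 = Tag T2"
    and same_k: "\<And>p1 p2 a1 b1 c1 d1 k1 a2 b2 c2 d2 k2. (p1, (a1, b1, c1, d1, k1)) \<in> leaf_trans A1 \<Longrightarrow>
      (p2, (a2, b2, c2, d2, k2)) \<in> leaf_trans A2 \<Longrightarrow> k1 = k2"
  shows "is_run (Bin A1 A2 s) (tree_pm s T1 T2) (\<lambda>p. (\<rho>1 p, \<rho>2 p))"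
  using assms(1-3)
proof (induction T1 arbitrary: T2 \<rho>1 \<rho>2)
  case (Leaf x)
  then obtain y where T2: "T2 = Leaf y" by (cases T2) (auto simp: Tag_def)
  obtain a1 b1 c1 d1 k1 where x: "x = (a1, b1, c1, d1, k1)" by (cases x)
  obtain a2 b2 c2 d2 k2 where y: "y = (a2, b2, c2, d2, k2)" by (cases y)
  have trans: "(\<rho>1 [], (a1, b1, c1, d1, k1)) \<in> leaf_trans A1" "(\<rho>2 [], (a2, b2, c2, d2, k2)) \<in> leaf_trans A2"
    using Leaf x y T2 by simp_all
  \<comment> \<open>Equal exponents select the componentwise branch of \<open>amp_pm\<close> rather
    than the arbitrary representative given by \<open>SOME\<close>.\<close>
  then have "k1 = k2" by (rule same_k)
  with trans have "((\<rho>1 [], \<rho>2 []), amp_pm s x y) \<in> Bin_leaf A1 A2 s"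
    unfolding Bin_leaf_def x y amp_pm.simps by (simp only: if_True refl) blast
  then show ?case by (simp add: T2 Bin_def)
next
  case (Node f l r)
  \<comment> \<open>Equal tags force the same symbol at both roots, which is what
    \<open>Bin_trans\<close> asks of the two transitions.\<close>
  then obtain l' r' where "T2 = Node f l' r'" by (cases T2) (auto simp: Tag_def)
  with Node show ?case by (auto simp: Tag_def Bin_def Bin_trans_def)
qed

text \<open>A sum does not determine its summands, so the operands are read off the run: each leaf
  transition of the product comes from a pair of leaf transitions, whose constants become the leaves
  of \<open>T1\<close> and \<open>T2\<close>.\<close>

lemma is_run_Bin_proj:
  assumes "is_run (Bin A1 A2 s) T \<rho>"
  shows "\<exists>T1 T2. T = tree_pm s T1 T2 \<and> Tag T1 = Tag T2 \<and>
    is_run A1 T1 (\<lambda>p. fst (\<rho> p)) \<and> is_run A2 T2 (\<lambda>p. snd (\<rho> p))"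
  using assms
proof (induction T arbitrary: \<rho>)
  case (Leaf x)
  then have "(\<rho> [], x) \<in> Bin_leaf A1 A2 s" by (simp add: Bin_def)
  then obtain p1 p2 a1 b1 c1 d1 a2 b2 c2 d2 k where
    "\<rho> [] = (p1, p2)" "x = (app_pm s a1 a2, app_pm s b1 b2, app_pm s c1 c2, app_pm s d1 d2, k)"
    "(p1, (a1, b1, c1, d1, k)) \<in> leaf_trans A1" "(p2, (a2, b2, c2, d2, k)) \<in> leaf_trans A2"
    unfolding Bin_leaf_def by blast
  then show ?case
    \<comment> \<open>Both constants carry the same \<open>k\<close>, so \<open>amp_pm\<close>
      recombines them to \<open>x\<close>.\<close>
    by (intro exI[of _ "Leaf (a1, b1, c1, d1, k)"] exI[of _ "Leaf (a2, b2, c2, d2, k)"])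
      (simp add: Tag_def)
next
  case (Node f l r)
  obtain l1 l2 where "l = tree_pm s l1 l2" "Tag l1 = Tag l2"
    "is_run A1 l1 (\<lambda>p. fst (\<rho> (False # p)))" "is_run A2 l2 (\<lambda>p. snd (\<rho> (False # p)))"
    using Node.IH(1)[of "\<lambda>p. \<rho> (False # p)"] Node.prems by auto
  moreover obtain r1 r2 where "r = tree_pm s r1 r2" "Tag r1 = Tag r2"
    "is_run A1 r1 (\<lambda>p. fst (\<rho> (True # p)))" "is_run A2 r2 (\<lambda>p. snd (\<rho> (True # p)))"
    using Node.IH(2)[of "\<lambda>p. \<rho> (True # p)"] Node.prems by auto
  moreover have "(fst (\<rho> []), f, fst (\<rho> [False]), fst (\<rho> [True])) \<in> internal_trans A1"
    "(snd (\<rho> []), f, snd (\<rho> [False]), snd (\<rho> [True])) \<in> internal_trans A2"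
    using Node.prems by (auto simp: Bin_def Bin_trans_def)
  \<comment> \<open>Reusing \<open>f\<close> at both roots keeps the tags equal.\<close>
  ultimately show ?case
    by (intro exI[of _ "Node f l1 r1"] exI[of _ "Node f l2 r2"]) (simp add: Tag_def)
qed

theorem theorem6p12:
  fixes A1 :: "('q1, 'j tsym, amp_sym) ta"
    and A2 :: "('q2, 'j tsym, amp_sym) ta"
    and \<Sigma> :: "('j tsym, amp_sym) ranked_alphabet"
    and q1 :: 'q1 and q2 :: 'q2
    and n :: nat and k :: int and s :: pm
  assumes "tagged_ta A1" and "tagged_ta A2"
    and "alphabet A1 = \<Sigma>" and "alphabet A2 = \<Sigma>"
    and "root_states A1 = {q1}" and "root_states A2 = {q2}"
    and "\<forall>T\<in>lang A1. tagged_tree n T" and "\<forall>T\<in>lang A2. tagged_tree n T"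
    and "\<forall>q a b c d k'. (q, (a, b, c, d, k')) \<in> leaf_trans A1 \<longrightarrow> k' = k"
    and "\<forall>q a b c d k'. (q, (a, b, c, d, k')) \<in> leaf_trans A2 \<longrightarrow> k' = k"
  shows "lang (Bin A1 A2 s) =
    {tree_pm s T1 T2 | T1 T2. T1 \<in> lang A1 \<and> T2 \<in> lang A2 \<and> Tag T1 = Tag T2}"
proof (intro subset_antisym subsetI)
  fix T assume "T \<in> lang (Bin A1 A2 s)"
  then obtain \<rho> where run: "is_run (Bin A1 A2 s) T \<rho>"
    and root: "\<rho> [] \<in> root_states A1 \<times> root_states A2"
    by (auto simp: lang_def Bin_def)
  obtain T1 T2 where "T = tree_pm s T1 T2" "Tag T1 = Tag T2"
    "is_run A1 T1 (\<lambda>p. fst (\<rho> p))" "is_run A2 T2 (\<lambda>p. snd (\<rho> p))"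
    using is_run_Bin_proj[OF run] by blast
  moreover have "fst (\<rho> []) \<in> root_states A1" "snd (\<rho> []) \<in> root_states A2"
    using root by auto
  ultimately show "T \<in> {tree_pm s T1 T2 | T1 T2. T1 \<in> lang A1 \<and> T2 \<in> lang A2 \<and> Tag T1 = Tag T2}"
    unfolding lang_def by blast
next
  fix T assume "T \<in> {tree_pm s T1 T2 | T1 T2. T1 \<in> lang A1 \<and> T2 \<in> lang A2 \<and> Tag T1 = Tag T2}"
  then obtain T1 T2 \<rho>1 \<rho>2 where T: "T = tree_pm s T1 T2"
    and runs: "is_run A1 T1 \<rho>1" "is_run A2 T2 \<rho>2" "Tag T1 = Tag T2"
    and roots: "\<rho>1 [] \<in> root_states A1" "\<rho>2 [] \<in> root_states A2"
    unfolding lang_def by blast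
  \<comment> \<open>Any two leaf exponents agree because both equal \<open>k\<close>.\<close>
  have "is_run (Bin A1 A2 s) T (\<lambda>p. (\<rho>1 p, \<rho>2 p))"
    unfolding T using assms(9,10) by (intro is_run_Bin_pair runs) metis
  moreover have "(\<rho>1 [], \<rho>2 []) \<in> root_states (Bin A1 A2 s)"
    using roots by (simp add: Bin_def)
  ultimately show "T \<in> lang (Bin A1 A2 s)"
    unfolding lang_def by blast
qed

end
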